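(* Let $v$ and $q$ be positive integers, $v$ not a square. Let $m,n$ be integers with $(m,q)=(n,q)=1$, and let $x=m/q+\sqrt v$, $y=n/q+\sqrt v$. Let $q_1=(m-n,q)$. Then $x\sim y$ if, and only if, there is a pair $(r,c)\in\mathbb{Z}^2$ such that $r^2-c^2v=\pm 1$ (i.e. $r^2-c^2v\in\{1,-1\}$) and $(c,q^2)=qq_1$.
   Context: $(a,b)$ denotes the (positive) greatest common divisor of the integers $a,b$; in particular $(0,b)=|b|$. Two real quadratic irrationals $x,y$ are called equivalent, written $x\sim y$, if their regular continued fraction expansions can be written with the same period, i.e. $x=[a_0,\ldots,a_{j-1},[b_1,\ldots,b_k]]$ and $y=[c_0,\ldots,c_{l-1},[b_1,\ldots,b_k]]$, where the inner bracket $[b_1,\ldots,b_k]$ is the common period, repeated indefinitely, and the pre-periods may be empty. By a classical theorem of Serret, $x\sim y$ is the same as: there are $a,b,c,d\in\mathbb{Z}$ with $ad-bc=\pm1$ and $y=\frac{ax+b}{cx+d}$. *)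

theory Defs
  imports Complex_Main "HOL-Library.Stream"
begin

(* The regular continued fraction expansion [a_0, a_1, a_2, ...] of an irrational x: the floors
   of its complete quotients x_0 = x, x_(k+1) = 1 / (x_k - floor x_k).  For rational x, where the
   true expansion is finite, the stream is padded with zeros because 1 / 0 = 0; only irrational
   arguments are meant. *)
definition cfrac_expansion :: "real \<Rightarrow> int stream" where
  "cfrac_expansion x = smap floor (siterate (\<lambda>t. 1 / frac t) x)"

(* Both expansions are a (possibly empty) pre-period followed by the same nonempty period bs
   repeated indefinitely; intended for real quadratic irrationals x and y. *)
definition cfrac_equiv :: "real \<Rightarrow> real \<Rightarrow> bool" (infix "\<sim>" 50) where
  "x \<sim> y \<longleftrightarrow> (\<exists>as cs bs. bs \<noteq> [] \<and>
     cfrac_expansion x = as @- cycle bs \<and> cfrac_expansion y = cs @- cycle bs)"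

end

theory Submission imports Defs "HOL-Number_Theory.Cong" begin

text \<open>
  Having a common period means the same as being related by an integral matrix of determinant
  \<open>\<plusminus>1\<close> (Serret, Lagrange). For \<open>x = m/q + \<surd>v\<close> and \<open>y = n/q + \<surd>v\<close> both irrational parts are
  \<open>\<surd>v\<close>, and comparing coefficients of \<open>1\<close> and \<open>\<surd>v\<close> shows which matrices occur: they are given by
  units \<open>r + q e \<surd>v\<close> of norm \<open>\<plusminus>1\<close> with \<open>q dvd (n - m) r - m n e\<close>
  (\<open>unimodular_related_iff_unit\<close>; the lower left entry of the matrix is \<open>c = q e\<close>).

  As \<open>r\<close>, \<open>m\<close>, \<open>n\<close> are prime to \<open>q\<close>, this divisibility forces \<open>gcd e q = gcd (m - n) q\<close>, that is,
  \<open>gcd c (q\<^sup>2) = q * q1\<close>. The gcd condition alone is weaker than the divisibility for the same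
  unit, but the unit may be replaced by a power: modulo \<open>q\<close>, the \<open>k\<close>-th power has coefficients
  \<open>r^k\<close> and \<open>k r^(k-1) e\<close>, so that the divisibility becomes the linear congruence
  \<open>m n e k \<equiv> (n - m) r\<close> for \<open>k\<close>, and this is solvable because
  \<open>gcd (m n e) q = gcd (m - n) q\<close> divides the right-hand side (\<open>unit_congruence_iff_gcd\<close>).

  Underlying the passage to matrices is one fact: an irrational number is determined by the
  floors of its complete quotients (\<open>eq_floors_imp_eq\<close>). For Serret's theorem,
  integral matrices of determinant \<open>\<plusminus>1\<close> are decomposed by the Euclidean algorithm into
  \<open>t \<mapsto> t + a\<close>, \<open>t \<mapsto> -t\<close> and \<open>t \<mapsto> 1/t\<close>, none of which alters the tail of the expansion. For
  Lagrange's theorem, a quadratic irrational and its conjugate are expanded side by side: the two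
  cannot have the same floors forever, and soon after the first difference the conjugate is negative. From then on only finitely many values are possible, because the
  discriminant of the quadratic equation stays the same.
\<close>

section \<open>Complete quotients\<close>

definition cf_step :: "real \<Rightarrow> real" where
  "cf_step t = 1 / frac t"

lemma cfrac_expansion_conv_cf_step: "cfrac_expansion x = smap floor (siterate cf_step x)"
  by (simp add: cfrac_expansion_def cf_step_def[abs_def])

lemma snth_cfrac_expansion: "cfrac_expansion x !! k = \<lfloor>(cf_step ^^ k) x\<rfloor>"
  by (simp add: cfrac_expansion_conv_cf_step)

lemma sdrop_cfrac_expansion: "sdrop k (cfrac_expansion x) = cfrac_expansion ((cf_step ^^ k) x)"
  by (simp add: cfrac_expansion_conv_cf_step)

lemma inverse_shift_irrational: "x \<notin> \<rat> \<Longrightarrow> 1 / (x - of_int a) \<notin> \<rat>"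
  for x :: real
  by (metis Rats_add Rats_inverse_iff Rats_of_int diff_add_cancel inverse_eq_divide)

lemma cf_step_irrational: "x \<notin> \<rat> \<Longrightarrow> cf_step x \<notin> \<rat>"
  unfolding cf_step_def frac_def by (rule inverse_shift_irrational)

lemma cf_iterate_irrational: "x \<notin> \<rat> \<Longrightarrow> (cf_step ^^ k) x \<notin> \<rat>"
  by (induction k) (simp_all add: cf_step_irrational)

lemma frac_pos_irrational: "x \<notin> \<rat> \<Longrightarrow> frac x > 0" for x :: real
  using Ints_subset_Rats by auto

lemma cf_step_gt_1: "x \<notin> \<rat> \<Longrightarrow> cf_step x > 1"
  using frac_pos_irrational[of x] frac_lt_1[of x] by (simp add: cf_step_def field_simps)

text \<open>A single step \<open>t \<mapsto> 1 / frac t\<close> has no expansion factor bounded away from \<open>1\<close>, but two consecutive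
steps have one: the product bounded here is the contraction, per point, of undoing two steps.\<close>

lemma frac_mult_frac_cf_step:
  assumes "x \<notin> \<rat>"
  shows "0 < frac x * frac (cf_step x)" "frac x * frac (cf_step x) < 1 / 2"
proof -
  have f: "0 < frac x" "frac x < 1" "0 < frac (cf_step x)" "frac (cf_step x) < 1"
    using frac_pos_irrational assms cf_step_irrational frac_lt_1 by auto
  then show "0 < frac x * frac (cf_step x)" by simp
  have "\<lfloor>cf_step x\<rfloor> \<ge> 1" using cf_step_gt_1[OF assms] by linarith
  then have "cf_step x \<ge> 1 + frac (cf_step x)"
    unfolding frac_def by linarith
  then have "frac x * cf_step x \<ge> frac x * (1 + frac (cf_step x))"
    using f by (intro mult_left_mono) auto
  moreover have "frac x * cf_step x = 1" using f by (simp add: cf_step_def)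
  moreover have "frac x * frac (cf_step x) < frac x * 1"
    using f by (intro mult_strict_left_mono) auto
  ultimately show "frac x * frac (cf_step x) < 1 / 2" by (simp add: algebra_simps)
qed

lemma diff_eq_diff_cf_step:
  assumes "x \<notin> \<rat>" "y \<notin> \<rat>" "\<lfloor>x\<rfloor> = \<lfloor>y\<rfloor>"
  shows "x - y = (cf_step y - cf_step x) * (frac x * frac y)"
proof -
  have "x - y = frac x - frac y" using assms(3) by (simp add: frac_def)
  also have "\<dots> = (cf_step y - cf_step x) * (frac x * frac y)"
    using frac_pos_irrational[OF assms(1)] frac_pos_irrational[OF assms(2)]
    by (simp add: cf_step_def left_diff_distrib)
  finally show ?thesis .
qed

text \<open>As long as the floors agree, two steps of the continued fraction expansion multiply the distance
by more than \<open>4\<close>, and points with equal floors have distance less than \<open>1\<close>.\<close>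

lemma eq_floors_imp_close:
  assumes "x \<notin> \<rat>" "y \<notin> \<rat>" "\<And>k. \<lfloor>(cf_step ^^ k) x\<rfloor> = \<lfloor>(cf_step ^^ k) y\<rfloor>"
  shows "\<bar>x - y\<bar> \<le> (1 / 4) ^ n"
  using assms
proof (induction n arbitrary: x y)
  case 0
  from 0(3)[of 0] have "\<lfloor>x\<rfloor> = \<lfloor>y\<rfloor>" by simp
  then show ?case by simp linarith
next
  case (Suc n)
  define u v where "u = cf_step x" and "v = cf_step y"
  define u' v' where "u' = cf_step u" and "v' = cf_step v"
  have irr: "u \<notin> \<rat>" "v \<notin> \<rat>" "u' \<notin> \<rat>" "v' \<notin> \<rat>"
    using Suc.prems by (auto simp: u_def v_def u'_def v'_def cf_step_irrational)
  have fl: "\<lfloor>x\<rfloor> = \<lfloor>y\<rfloor>" "\<lfloor>u\<rfloor> = \<lfloor>v\<rfloor>"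
    using Suc.prems(3)[of 0] Suc.prems(3)[of 1] by (simp_all add: u_def v_def)
  have "\<lfloor>(cf_step ^^ k) u'\<rfloor> = \<lfloor>(cf_step ^^ k) v'\<rfloor>" for k
    using Suc.prems(3)[of "Suc (Suc k)"]
    by (simp only: funpow_Suc_right o_apply u_def v_def u'_def v'_def)
  then have IH: "\<bar>u' - v'\<bar> \<le> (1 / 4) ^ n" using Suc.IH irr by blast
  define a b where "a = frac x * frac u" and "b = frac y * frac v"
  have ab: "0 < a" "a < 1 / 2" "0 < b" "b < 1 / 2"
    unfolding a_def b_def u_def v_def
    using frac_mult_frac_cf_step[OF Suc.prems(1)] frac_mult_frac_cf_step[OF Suc.prems(2)] by auto
  have "x - y = (v - u) * (frac x * frac y)"
    unfolding u_def v_def by (rule diff_eq_diff_cf_step) (use Suc.prems fl in auto)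
  moreover have "u - v = (v' - u') * (frac u * frac v)"
    unfolding u'_def v'_def by (rule diff_eq_diff_cf_step) (use irr fl in auto)
  ultimately have "x - y = (u' - v') * (a * b)"
    unfolding a_def b_def by algebra
  then have "\<bar>x - y\<bar> = \<bar>u' - v'\<bar> * (a * b)" using ab by (simp add: abs_mult)
  also have "\<dots> \<le> (1 / 4) ^ n * (1 / 2 * (1 / 2))"
    using ab IH by (intro mult_mono) auto
  finally show ?case by simp
qed

lemma eq_floors_imp_eq:
  assumes "x \<notin> \<rat>" "y \<notin> \<rat>" "\<And>k. \<lfloor>(cf_step ^^ k) x\<rfloor> = \<lfloor>(cf_step ^^ k) y\<rfloor>"
  shows "x = y"
proof (rule ccontr)
  assume "x \<noteq> y"
  then obtain n where "(1 / 4 :: real) ^ n < \<bar>x - y\<bar>"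
    using real_arch_pow_inv[of "\<bar>x - y\<bar>" "1 / 4"] by auto
  then show False using eq_floors_imp_close[OF assms, of n] by simp
qed

lemma cfrac_expansion_inj:
  assumes "x \<notin> \<rat>" "y \<notin> \<rat>" "cfrac_expansion x = cfrac_expansion y"
  shows "x = y"
  using assms by (intro eq_floors_imp_eq) (simp_all flip: snth_cfrac_expansion)

section \<open>Serret's theorem\<close>

text \<open>Comparing complete quotients, and not tails of the expansion, makes the invariance under
the generators of the unimodular group a computation with finitely many steps of real arithmetic.\<close>

definition tail_equiv :: "real \<Rightarrow> real \<Rightarrow> bool" where
  "tail_equiv x y \<longleftrightarrow> (\<exists>k l. (cf_step ^^ k) x = (cf_step ^^ l) y)"

lemma tail_equivI: "(cf_step ^^ k) x = (cf_step ^^ l) y \<Longrightarrow> tail_equiv x y"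
  unfolding tail_equiv_def by blast

lemma tail_equiv_sym: "tail_equiv x y \<Longrightarrow> tail_equiv y x"
  unfolding tail_equiv_def by metis

lemma tail_equiv_trans:
  assumes "tail_equiv x y" "tail_equiv y z"
  shows "tail_equiv x z"
proof -
  obtain k l k' l' where "(cf_step ^^ k) x = (cf_step ^^ l) y"
    "(cf_step ^^ k') y = (cf_step ^^ l') z"
    using assms unfolding tail_equiv_def by blast
  then have "(cf_step ^^ (k' + k)) x = (cf_step ^^ (l + l')) z"
    by (metis add.commute comp_apply funpow_add)
  then show ?thesis by (rule tail_equivI)
qed

lemma tail_equiv_add_int: "tail_equiv x (x + of_int a)"
  by (rule tail_equivI[of 1 _ 1]) (simp add: cf_step_def)

lemma tail_equiv_uminus:
  assumes "x \<notin> \<rat>"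
  shows "tail_equiv x (- x)"
proof -
  \<comment> \<open>By symmetry only the case of a small fractional part has to be computed: with
    \<open>f = frac x < 1/2\<close> the second complete quotient of \<open>-x\<close> is \<open>(1 - f)/f = 1/f - 1\<close>, an integer
    translate of the first complete quotient \<open>1/f\<close> of \<open>x\<close>.\<close>
  have small: "tail_equiv t (- t)" if t: "t \<notin> \<rat>" "frac t < 1 / 2" for t
  proof -
    define f where "f = frac t"
    have f: "0 < f" "f < 1 / 2" using frac_pos_irrational t by (auto simp: f_def)
    have "frac (- t) = 1 - f" using t f by (auto simp: frac_neg f_def)
    then have 1: "cf_step (- t) = 1 / (1 - f)" by (simp add: cf_step_def)
    have "frac (1 / (1 - f)) = f / (1 - f)"
      unfolding frac_unique_iff using f by (auto simp: field_simps)
    then have "cf_step (cf_step (- t)) = (1 - f) / f"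
      unfolding 1 by (simp add: cf_step_def)
    also have "\<dots> = 1 / f - 1" using f by (simp add: diff_divide_distrib)
    finally have "cf_step (cf_step (- t)) = 1 / f - 1" .
    then have "cf_step (cf_step (- t)) = cf_step t + of_int (- 1)"
      by (simp add: cf_step_def f_def)
    then have "(cf_step ^^ 2) (- t) = (cf_step ^^ 1) t + of_int (- 1)"
      by (simp add: numeral_2_eq_2)
    then have "tail_equiv ((cf_step ^^ 1) t) ((cf_step ^^ 2) (- t))"
      by (metis tail_equiv_add_int)
    moreover have "tail_equiv t ((cf_step ^^ 1) t)" by (rule tail_equivI[of 1 _ 0]) simp
    moreover have "tail_equiv ((cf_step ^^ 2) (- t)) (- t)" by (rule tail_equivI[of 0 _ 2]) simp
    ultimately show ?thesis by (meson tail_equiv_trans)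
  qed
  have "frac x \<noteq> 1 / 2"
  proof
    assume "frac x = 1 / 2"
    then have "frac x \<in> \<rat>" by (simp only: Rats_divide Rats_1 Rats_number_of)
    then show False using assms by simp
  qed
  moreover have "frac (- x) = 1 - frac x"
    using frac_pos_irrational[OF assms] by (simp add: frac_neg)
  ultimately consider "frac x < 1 / 2" | "frac (- x) < 1 / 2" by linarith
  then show ?thesis
  proof cases
    case 1
    then show ?thesis using small assms by blast
  next
    case 2
    then show ?thesis using small[of "- x"] assms tail_equiv_sym by simp
  qed
qed

text \<open>One of \<open>x\<close> and \<open>1/x\<close> lies in \<open>(0, 1)\<close>, and the first step of its expansion is inversion.\<close>

lemma tail_equiv_inverse_pos:
  assumes "x \<notin> \<rat>" "x > 0"
  shows "tail_equiv x (1 / x)"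
proof (cases "x < 1")
  case True
  then have "cf_step x = 1 / x" using assms by (simp add: cf_step_def)
  then show ?thesis by (intro tail_equivI[of 1 _ 0]) simp
next
  case False
  then have "x > 1" using assms(1) by (cases "x = 1") auto
  then have "cf_step (1 / x) = x" by (simp add: cf_step_def)
  then show ?thesis by (intro tail_equivI[of 0 _ 1]) simp
qed

lemma tail_equiv_inverse:
  assumes "x \<notin> \<rat>"
  shows "tail_equiv x (1 / x)"
proof (cases "x > 0")
  case True
  then show ?thesis using assms tail_equiv_inverse_pos by blast
next
  case False
  then have "- x > 0" using assms by (cases "x = 0") auto
  then have "tail_equiv (- x) (1 / (- x))" using assms by (intro tail_equiv_inverse_pos) auto
  moreover have "tail_equiv x (- x)" by (rule tail_equiv_uminus) fact
  moreover have "tail_equiv (1 / (- x)) (- (1 / (- x)))"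
    using assms inverse_shift_irrational[of "- x" 0] by (intro tail_equiv_uminus) simp
  ultimately have "tail_equiv x (- (1 / (- x)))" by (meson tail_equiv_trans)
  then show ?thesis by simp
qed

text \<open>This is \<open>y = (a x + b) / (c x + d)\<close> with the denominator cleared, which is harmless for
irrational \<open>x\<close> since then \<open>c x + d \<noteq> 0\<close>. In this form symmetry and transitivity are polynomial
identities.\<close>

definition unimodular_related :: "real \<Rightarrow> real \<Rightarrow> bool" where
  "unimodular_related x y \<longleftrightarrow> (\<exists>a b c d :: int. \<bar>a * d - b * c\<bar> = 1 \<and>
     y * (of_int c * x + of_int d) = of_int a * x + of_int b)"

text \<open>The Euclidean algorithm on the first column \<open>(a, c)\<close> of the matrix: subtracting the integer
\<open>a div c\<close> from \<open>y\<close> and inverting replaces \<open>(a, c)\<close> by \<open>(c, a mod c)\<close>. When \<open>c = 0\<close>, only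
\<open>\<plusminus>x\<close> plus an integer remains.\<close>

lemma unimodular_imp_tail_equiv:
  fixes a b c d :: int
  assumes "x \<notin> \<rat>" "y \<notin> \<rat>" "\<bar>a * d - b * c\<bar> = 1"
    and "y * (of_int c * x + of_int d) = of_int a * x + of_int b"
  shows "tail_equiv x y"
  using assms
proof (induction "nat \<bar>c\<bar>" arbitrary: a b c d y rule: less_induct)
  case less
  show ?case
  proof (cases "c = 0")
    case True
    then have ad: "a * d = 1 \<or> a * d = - 1" using less.prems(3) by auto
    then have "(a = d \<or> a = - d) \<and> (d = 1 \<or> d = - 1)"
      by (auto simp: zmult_eq_1_iff zmult_eq_neg1_iff)
    then have "y = x + of_int (d * b) \<or> y = - x + of_int (d * b)"
      using less.prems(4) True by auto
    then show ?thesis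
      using tail_equiv_add_int tail_equiv_uminus[OF less.prems(1)] tail_equiv_trans by metis
  next
    case False
    define k where "k = a div c"
    define a' b' where "a' = a mod c" and "b' = b - k * d"
    have a: "a = k * c + a'" by (simp add: k_def a'_def)
    have b: "b = k * d + b'" by (simp add: b'_def)
    define z where "z = y - of_int k"
    have z: "1 / z \<notin> \<rat>" unfolding z_def using less.prems(2) by (rule inverse_shift_irrational)
    then have "z \<noteq> 0" by auto
    have "z * (of_int c * x + of_int d) = of_int a' * x + of_int b'"
      using less.prems(4) unfolding z_def a b by (simp add: algebra_simps)
    then have eq: "(1 / z) * (of_int a' * x + of_int b') = of_int c * x + of_int d"
      using \<open>z \<noteq> 0\<close> by (simp add: field_simps)
    have "c * b' - d * a' = - (a * d - b * c)" unfolding a b by (simp add: algebra_simps)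
    then have det: "\<bar>c * b' - d * a'\<bar> = 1" using less.prems(3) by simp
    have "nat \<bar>a'\<bar> < nat \<bar>c\<bar>"
      using abs_mod_less[OF False, of a] by (simp add: a'_def)
    then have "tail_equiv x (1 / z)"
      by (rule less.hyps[OF _ less.prems(1) z det eq])
    moreover have "tail_equiv (1 / z) z" using tail_equiv_inverse[OF z] by simp
    moreover have "tail_equiv z y" using tail_equiv_add_int[of z k] by (simp add: z_def)
    ultimately show ?thesis by (meson tail_equiv_trans)
  qed
qed


lemma unimodular_related_refl: "unimodular_related x x"
  unfolding unimodular_related_def
  by (rule exI[of _ 1], rule exI[of _ 0], rule exI[of _ 0], rule exI[of _ 1]) simp

lemma unimodular_related_sym:
  assumes "unimodular_related x y"
  shows "unimodular_related y x"
proof -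
  obtain a b c d :: int where abcd: "\<bar>a * d - b * c\<bar> = 1"
    "y * (of_int c * x + of_int d) = of_int a * x + of_int b"
    using assms unfolding unimodular_related_def by blast
  have "\<bar>d * a - (- b) * (- c)\<bar> = 1" using abcd(1) by (simp add: algebra_simps)
  moreover have "x * (of_int (- c) * y + of_int a) = of_int d * y + of_int (- b)"
    using abcd(2) by (simp add: algebra_simps)
  ultimately show ?thesis unfolding unimodular_related_def by blast
qed

lemma unimodular_related_trans:
  assumes "unimodular_related x y" "unimodular_related y z"
  shows "unimodular_related x z"
proof -
  obtain a b c d :: int where 1: "\<bar>a * d - b * c\<bar> = 1"
    "y * (of_int c * x + of_int d) = of_int a * x + of_int b"
    using assms(1) unfolding unimodular_related_def by blast
  obtain a' b' c' d' :: int where 2: "\<bar>a' * d' - b' * c'\<bar> = 1"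
    "z * (of_int c' * y + of_int d') = of_int a' * y + of_int b'"
    using assms(2) unfolding unimodular_related_def by blast
  have "(a' * a + b' * c) * (c' * b + d' * d) - (a' * b + b' * d) * (c' * a + d' * c)
      = (a' * d' - b' * c') * (a * d - b * c)"
    by (simp add: algebra_simps)
  then have "\<bar>(a' * a + b' * c) * (c' * b + d' * d) - (a' * b + b' * d) * (c' * a + d' * c)\<bar> = 1"
    using 1(1) 2(1) by (simp add: abs_mult)
  moreover have "z * (of_int (c' * a + d' * c) * x + of_int (c' * b + d' * d))
      = of_int (a' * a + b' * c) * x + of_int (a' * b + b' * d)"
    using 1(2) 2(2) by (simp only: of_int_add of_int_mult) algebra
  ultimately show ?thesis unfolding unimodular_related_def by blast
qed

lemma unimodular_related_cf_step:
  assumes "x \<notin> \<rat>"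
  shows "unimodular_related x (cf_step x)"
proof -
  have "cf_step x * (of_int 1 * x + of_int (- \<lfloor>x\<rfloor>)) = of_int 0 * x + of_int 1"
    using frac_pos_irrational[OF assms] by (simp add: cf_step_def frac_def)
  moreover have "\<bar>0 * (- \<lfloor>x\<rfloor>) - 1 * 1\<bar> = (1 :: int)" by simp
  ultimately show ?thesis unfolding unimodular_related_def by blast
qed

lemma unimodular_related_cf_iterate:
  assumes "x \<notin> \<rat>"
  shows "unimodular_related x ((cf_step ^^ k) x)"
proof (induction k)
  case 0
  then show ?case by (simp add: unimodular_related_refl)
next
  case (Suc k)
  then show ?case
    using unimodular_related_cf_step[OF cf_iterate_irrational[OF assms, of k]]
    by (auto intro: unimodular_related_trans)
qed

theorem serret:
  assumes "x \<notin> \<rat>" "y \<notin> \<rat>"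
  shows "tail_equiv x y \<longleftrightarrow> unimodular_related x y"
proof
  assume "unimodular_related x y"
  then show "tail_equiv x y"
    unfolding unimodular_related_def using unimodular_imp_tail_equiv[OF assms] by blast
next
  assume "tail_equiv x y"
  then obtain k l where "(cf_step ^^ k) x = (cf_step ^^ l) y"
    unfolding tail_equiv_def by blast
  then show "unimodular_related x y"
    using unimodular_related_cf_iterate[OF assms(1), of k]
      unimodular_related_cf_iterate[OF assms(2), of l]
    by (metis unimodular_related_sym unimodular_related_trans)
qed

section \<open>Lagrange's theorem\<close>

text \<open>The numbers \<open>x\<close> and \<open>x'\<close> are the two roots of \<open>A t\<^sup>2 + B t + C\<close>, of discriminant \<open>D\<close>. Expressing
this by their sum and product keeps the roles of the two roots symmetric.\<close>

definition conjugate_pair :: "int \<Rightarrow> real \<Rightarrow> real \<Rightarrow> bool" where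
  "conjugate_pair D x x' \<longleftrightarrow> x \<notin> \<rat> \<and> x' \<notin> \<rat> \<and> x \<noteq> x' \<and>
     (\<exists>A B C :: int. A \<noteq> 0 \<and> of_int B = - of_int A * (x + x') \<and> of_int C = of_int A * (x * x') \<and>
        D = B\<^sup>2 - 4 * A * C)"

text \<open>Translation and inversion act on binary quadratic forms by unimodular substitutions, which
preserve the discriminant.\<close>

lemma conjugate_pair_step:
  assumes "conjugate_pair D x x'"
  shows "conjugate_pair D (1 / (x - of_int a)) (1 / (x' - of_int a))"
proof -
  obtain A B C :: int where ABC: "A \<noteq> 0" "of_int B = - of_int A * (x + x')"
    "of_int C = of_int A * (x * x')" "D = B\<^sup>2 - 4 * A * C"
    and irr: "x \<notin> \<rat>" "x' \<notin> \<rat>" and neq: "x \<noteq> x'"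
    using assms unfolding conjugate_pair_def by blast
  define s t where "s = x - of_int a" and "t = x' - of_int a"
  have nz: "s \<noteq> 0" "t \<noteq> 0" using irr by (auto simp: s_def t_def)
  define A' B' where "A' = C + B * a + A * a\<^sup>2" and "B' = B + 2 * A * a"
  have "of_int A' = of_int A * (x * x') + (- of_int A * (x + x')) * of_int a
      + of_int A * (of_int a)\<^sup>2"
    unfolding A'_def by (simp only: of_int_add of_int_mult of_int_power ABC(2,3))
  also have "\<dots> = of_int A * (s * t)"
    unfolding s_def t_def by (simp add: algebra_simps power2_eq_square)
  finally have A': "of_int A' = of_int A * (s * t)" .
  have B': "of_int B' = - of_int A * (s + t)"
    using ABC(2) unfolding B'_def s_def t_def by (simp add: algebra_simps)
  have "A' \<noteq> 0" using A' nz ABC(1) by auto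
  moreover have "of_int B' = - of_int A' * (1 / s + 1 / t)"
    using nz unfolding A' B' by (simp add: field_simps)
  moreover have "of_int A = of_int A' * (1 / s * (1 / t))"
    using nz unfolding A' by simp
  moreover have "D = B'\<^sup>2 - 4 * A' * A"
    unfolding ABC(4) A'_def B'_def by (simp add: algebra_simps power2_eq_square)
  moreover have "1 / s \<notin> \<rat>" "1 / t \<notin> \<rat>"
    unfolding s_def t_def using irr by (simp_all add: inverse_shift_irrational)
  moreover have "1 / s \<noteq> 1 / t"
    using neq nz by (simp add: s_def t_def)
  ultimately show ?thesis unfolding conjugate_pair_def s_def[symmetric] t_def[symmetric] by blast
qed

lemma conjugate_pair_cf_step:
  "conjugate_pair D x x' \<Longrightarrow> conjugate_pair D (cf_step x) (1 / (x' - of_int \<lfloor>x\<rfloor>))"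
  using conjugate_pair_step[of D x x' "\<lfloor>x\<rfloor>"] by (simp add: cf_step_def frac_def)

text \<open>The opposite signs of the two roots force \<open>A * C < 0\<close>, so that the discriminant bounds the
coefficients.\<close>

definition reduced :: "int \<Rightarrow> real \<Rightarrow> bool" where
  "reduced D t \<longleftrightarrow> t > 1 \<and> (\<exists>t'<0. conjugate_pair D t t')"

lemma reduced_cf_step:
  assumes "reduced D t"
  shows "reduced D (cf_step t)"
proof -
  obtain t' where t: "t > 1" "t' < 0" "conjugate_pair D t t'"
    using assms unfolding reduced_def by blast
  have "t' - of_int \<lfloor>t\<rfloor> < 0" using t(1,2) by linarith
  then have "1 / (t' - of_int \<lfloor>t\<rfloor>) < 0" by simp
  moreover have "cf_step t > 1"
    using t(3) by (intro cf_step_gt_1) (simp add: conjugate_pair_def)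
  ultimately show ?thesis
    using conjugate_pair_cf_step[OF t(3)] unfolding reduced_def by blast
qed

lemma reduced_cf_iterate: "reduced D t \<Longrightarrow> reduced D ((cf_step ^^ k) t)"
  by (induction k) (auto intro: reduced_cf_step)

text \<open>Let the same sequence of floors, that of \<open>x\<close>, act on the conjugate. By uniqueness of the
expansion there is a first complete quotient \<open>t\<close> whose conjugate \<open>t'\<close> has a different floor. If
\<open>t'\<close> lies below the floor of \<open>t\<close>, the next conjugate is negative. If it lies above, the next
conjugate is in \<open>(0, 1)\<close>, below the floor of its partner, and one further step makes it negative.\<close>

lemma eventually_reduced:
  assumes "conjugate_pair D x x'"
  obtains k where "reduced D ((cf_step ^^ k) x)"
proof -
  have irr: "x \<notin> \<rat>" "x' \<notin> \<rat>" "x \<noteq> x'" using assms by (auto simp: conjugate_pair_def)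
  let ?P = "\<lambda>k. \<lfloor>(cf_step ^^ k) x\<rfloor> \<noteq> \<lfloor>(cf_step ^^ k) x'\<rfloor>"
  have "\<exists>k. ?P k" using eq_floors_imp_eq[of x x'] irr by blast
  define k where "k = (LEAST k. ?P k)"
  have k: "?P k" unfolding k_def using \<open>\<exists>k. ?P k\<close> by (rule LeastI_ex)
  have less: "\<not> ?P j" if "j < k" for j using that unfolding k_def by (rule not_less_Least)
  have pair: "conjugate_pair D ((cf_step ^^ j) x) ((cf_step ^^ j) x')" if "j \<le> k" for j
    using that
  proof (induction j)
    case 0
    then show ?case using assms by simp
  next
    case (Suc j)
    then have "\<lfloor>(cf_step ^^ j) x\<rfloor> = \<lfloor>(cf_step ^^ j) x'\<rfloor>" using less[of j] by simp
    then have "1 / ((cf_step ^^ j) x' - of_int \<lfloor>(cf_step ^^ j) x\<rfloor>) = (cf_step ^^ Suc j) x'"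
      by (simp add: cf_step_def[of "(cf_step ^^ j) x'"] frac_def)
    then show ?case
      using conjugate_pair_cf_step[of D "(cf_step ^^ j) x" "(cf_step ^^ j) x'"] Suc by simp
  qed
  define t t' where "t = (cf_step ^^ k) x" and "t' = (cf_step ^^ k) x'"
  have tt: "conjugate_pair D t t'" using pair[of k] by (simp add: t_def t'_def)
  have fl: "\<lfloor>t\<rfloor> \<noteq> \<lfloor>t'\<rfloor>" using k by (simp add: t_def t'_def)
  have t_irr: "t \<notin> \<rat>" "t' \<notin> \<rat>" using tt by (auto simp: conjugate_pair_def)
  define u u' where "u = cf_step t" and "u' = 1 / (t' - of_int \<lfloor>t\<rfloor>)"
  have uu: "conjugate_pair D u u'" unfolding u_def u'_def by (rule conjugate_pair_cf_step[OF tt])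
  have u: "u > 1" unfolding u_def by (rule cf_step_gt_1[OF t_irr(1)])
  show ?thesis
  proof (cases "t' < of_int \<lfloor>t\<rfloor>")
    case True
    then have "u' < 0" by (simp add: u'_def)
    then have "reduced D u" using u uu unfolding reduced_def by blast
    then show ?thesis using that[of "Suc k"] by (simp add: u_def t_def)
  next
    case False
    then have "t' \<ge> of_int \<lfloor>t\<rfloor> + 1" using fl by linarith
    then have "u' \<le> 1" by (simp add: u'_def field_simps)
    moreover have "u' \<noteq> 1" using uu by (auto simp: conjugate_pair_def)
    moreover have "1 \<le> \<lfloor>u\<rfloor>" using u by simp
    ultimately have "u' < of_int \<lfloor>u\<rfloor>" by linarith
    then have "1 / (u' - of_int \<lfloor>u\<rfloor>) < 0" by simp
    moreover have "cf_step u > 1" using uu by (intro cf_step_gt_1) (simp add: conjugate_pair_def)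
    ultimately have "reduced D (cf_step u)"
      using conjugate_pair_cf_step[OF uu] unfolding reduced_def by blast
    then show ?thesis using that[of "Suc (Suc k)"] by (simp add: u_def t_def)
  qed
qed

text \<open>From \<open>D = B\<^sup>2 + 4 * \<bar>A\<bar> * \<bar>C\<bar>\<close> both \<open>A\<close> and \<open>B\<close> are bounded by \<open>D\<close>, and together with the sign of
the square root they determine the root.\<close>

lemma finite_reduced: "finite {t. reduced D t}"
proof -
  define I where "I = {- \<bar>D\<bar>..\<bar>D\<bar>}"
  define h :: "(int \<times> int) \<times> real \<Rightarrow> real" where
    "h = (\<lambda>((A, B), s). (- of_int B + s * sqrt (of_int D)) / (2 * of_int A))"
  have "t \<in> h ` ((I \<times> I) \<times> {1, - 1})" if "reduced D t" for t
  proof -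
    obtain t' A B C where t: "t > 1" "t' < 0" and "A \<noteq> 0"
      and B: "of_int B = - of_int A * (t + t')" and C: "of_int C = of_int A * (t * t')"
      and D: "D = B\<^sup>2 - 4 * A * C"
      using \<open>reduced D t\<close> unfolding reduced_def conjugate_pair_def by blast
    have "of_int (A * C) = (of_int A)\<^sup>2 * (t * t')" using C by (simp add: power2_eq_square)
    also have "\<dots> < 0" using t \<open>A \<noteq> 0\<close> by (simp add: mult_pos_neg)
    finally have "A * C < 0" by (simp only: of_int_less_0_iff)
    then have "\<bar>A\<bar> * \<bar>C\<bar> = - (A * C)" "C \<noteq> 0" by (auto simp flip: abs_mult)
    moreover have "\<bar>A\<bar> \<le> \<bar>A\<bar> * \<bar>C\<bar>"
      using \<open>C \<noteq> 0\<close> mult_left_mono[of 1 "\<bar>C\<bar>" "\<bar>A\<bar>"] by simp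
    moreover have "\<bar>B\<bar> \<le> B\<^sup>2"
      using mult_left_mono[of 1 "\<bar>B\<bar>" "\<bar>B\<bar>"]
      by (cases "B = 0") (auto simp flip: power2_eq_square)
    ultimately have "\<bar>A\<bar> \<le> D" "\<bar>B\<bar> \<le> D" using D \<open>A * C < 0\<close> by (auto simp: mult.assoc)
    then have "A \<in> I" "B \<in> I" unfolding I_def by auto
    \<comment> \<open>Since \<open>w\<^sup>2 = D\<close>, this is the square root of \<open>D\<close> that belongs to the root \<open>t\<close>.\<close>
    define w where "w = of_int A * (t - t')"
    have "real_of_int D = (of_int B)\<^sup>2 - 4 * of_int A * of_int C" unfolding D by simp
    also have "\<dots> = w\<^sup>2" unfolding B C w_def by (simp add: algebra_simps power2_eq_square)
    finally have "\<bar>w\<bar> = sqrt (of_int D)" by simp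
    then obtain s :: real where "s \<in> {1, - 1}" "w = s * sqrt (of_int D)"
      by (metis abs_if insertI1 insertI2 minus_minus mult_1 mult_minus_left singletonI)
    moreover have "t = (- of_int B + w) / (2 * of_int A)"
      unfolding B w_def using \<open>A \<noteq> 0\<close> by (simp add: field_simps)
    ultimately have "t = h ((A, B), s)" by (simp add: h_def)
    then show ?thesis using \<open>A \<in> I\<close> \<open>B \<in> I\<close> \<open>s \<in> {1, - 1}\<close> by blast
  qed
  then have "{t. reduced D t} \<subseteq> h ` ((I \<times> I) \<times> {1, - 1})" by blast
  then show ?thesis by (rule finite_subset) (simp add: I_def)
qed

lemma shift_fixpoint_eq_cycle:
  assumes "xs \<noteq> []" "s = xs @- s"
  shows "s = cycle xs"
proof -
  have "s !! n = cycle xs !! n" for n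
  proof (induction n rule: less_induct)
    case (less n)
    have "s !! n = (if n < length xs then xs ! n else s !! (n - length xs))"
      by (subst assms(2)) (rule shift_snth)
    moreover have "cycle xs !! n = (if n < length xs then xs ! n else cycle xs !! (n - length xs))"
      by (subst cycle_decomp[OF assms(1)]) (rule shift_snth)
    moreover have "s !! (n - length xs) = cycle xs !! (n - length xs)" if "\<not> n < length xs"
      using that assms(1) by (intro less.IH) (cases xs; simp)
    ultimately show ?case by presburger
  qed
  then have "snth s = snth (cycle xs)" by blast
  then show ?thesis by (metis stream_smap_nats)
qed

text \<open>Infinitely many complete quotients lie in a finite set, so two of them coincide, and the
expansion repeats from there on.\<close>

theorem lagrange:
  assumes "conjugate_pair D x x'"
  obtains as bs where "bs \<noteq> []" "cfrac_expansion x = as @- cycle bs"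
proof -
  obtain k where k: "reduced D ((cf_step ^^ k) x)" using eventually_reduced[OF assms] .
  define t where "t = (cf_step ^^ k) x"
  have "range (\<lambda>i. (cf_step ^^ i) t) \<subseteq> {t. reduced D t}"
    using reduced_cf_iterate k by (auto simp: t_def)
  then have "finite (range (\<lambda>i. (cf_step ^^ i) t))"
    using finite_reduced finite_subset by blast
  then have "\<not> inj (\<lambda>i. (cf_step ^^ i) t)"
    using finite_imageD by blast
  then obtain i j where "i < j" and eq: "(cf_step ^^ i) t = (cf_step ^^ j) t"
    unfolding inj_def by (metis linorder_neqE_nat)
  define s where "s = cfrac_expansion ((cf_step ^^ i) t)"
  define p where "p = j - i"
  have "sdrop p s = cfrac_expansion ((cf_step ^^ (p + i)) t)"
    unfolding s_def sdrop_cfrac_expansion by (simp add: funpow_add)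
  also have "\<dots> = s" using \<open>i < j\<close> eq by (simp add: p_def s_def)
  finally have "s = stake p s @- s" by (metis stake_sdrop)
  moreover have "stake p s \<noteq> []" using \<open>i < j\<close> by (simp add: p_def)
  ultimately have "s = cycle (stake p s)" by (intro shift_fixpoint_eq_cycle) auto
  moreover have "s = sdrop (i + k) (cfrac_expansion x)"
    by (simp add: s_def t_def sdrop_cfrac_expansion funpow_add)
  ultimately have "cfrac_expansion x = stake (i + k) (cfrac_expansion x) @- cycle (stake p s)"
    by (metis stake_sdrop)
  then show ?thesis using that \<open>stake p s \<noteq> []\<close> by blast
qed

text \<open>A shared periodic tail is a shared complete quotient, because the expansion determines the number.
Conversely a shared complete quotient gives a shared tail, which is periodic by Lagrange's theorem
for \<open>x\<close>; the periodicity of the expansion of \<open>y\<close> is then inherited.\<close>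

theorem cfrac_equiv_iff_unimodular_related:
  assumes x: "conjugate_pair D x x'" and "y \<notin> \<rat>"
  shows "x \<sim> y \<longleftrightarrow> unimodular_related x y"
proof -
  have "x \<notin> \<rat>" using x by (simp add: conjugate_pair_def)
  have "x \<sim> y \<longleftrightarrow> tail_equiv x y"
  proof
    assume "x \<sim> y"
    then obtain as cs bs where "cfrac_expansion x = as @- cycle bs"
      "cfrac_expansion y = cs @- cycle bs"
      unfolding cfrac_equiv_def by blast
    then have "sdrop (length as) (cfrac_expansion x) = sdrop (length cs) (cfrac_expansion y)"
      by (simp add: sdrop_shift)
    then have "(cf_step ^^ length as) x = (cf_step ^^ length cs) y"
      unfolding sdrop_cfrac_expansion
      by (intro cfrac_expansion_inj cf_iterate_irrational \<open>x \<notin> \<rat>\<close> \<open>y \<notin> \<rat>\<close>)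
    then show "tail_equiv x y" by (rule tail_equivI)
  next
    assume "tail_equiv x y"
    then obtain k l where kl: "(cf_step ^^ k) x = (cf_step ^^ l) y"
      unfolding tail_equiv_def by blast
    obtain as bs where "bs \<noteq> []" and as: "cfrac_expansion x = as @- cycle bs"
      using lagrange[OF x] .
    define n where "n = length as"
    have "(cf_step ^^ (k + n)) x = (cf_step ^^ (l + n)) y"
      using kl by (metis add.commute funpow_add o_apply)
    then have eq: "sdrop (k + n) (cfrac_expansion x) = sdrop (l + n) (cfrac_expansion y)"
      by (simp add: sdrop_cfrac_expansion)
    \<comment> \<open>The complete quotient at index \<open>k\<close> may still belong to the pre-period of \<open>x\<close>. Going \<open>n\<close> steps
      further enters the period, possibly in its middle; hence the rotation.\<close>
    define ds where "ds = rotate (k mod length bs) bs"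
    have "sdrop (k + n) (cfrac_expansion x) = sdrop k (sdrop n (cfrac_expansion x))"
      by (simp add: add.commute)
    also have "\<dots> = cycle ds"
      using \<open>bs \<noteq> []\<close> by (simp add: as n_def sdrop_shift ds_def sdrop_cycle)
    finally have "cfrac_expansion x = stake (k + n) (cfrac_expansion x) @- cycle ds"
      "cfrac_expansion y = stake (l + n) (cfrac_expansion y) @- cycle ds"
      using eq by (metis stake_sdrop)+
    moreover have "ds \<noteq> []" using \<open>bs \<noteq> []\<close> by (simp add: ds_def)
    ultimately show "x \<sim> y" unfolding cfrac_equiv_def by blast
  qed
  then show ?thesis using serret[OF \<open>x \<notin> \<rat>\<close> \<open>y \<notin> \<rat>\<close>] by simp
qed

section \<open>Units and congruences\<close>

lemma sqrt_irrational:
  fixes v :: int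
  assumes "v > 0" "\<not> (\<exists>k::int. v = k\<^sup>2)"
  shows "sqrt (of_int v) \<notin> \<rat>"
proof
  assume "sqrt (of_int v) \<in> \<rat>"
  then obtain a b :: int where "b \<noteq> 0" and eq: "sqrt (of_int v) = of_int a / of_int b"
    by (metis Rats_cases' of_int_0_eq_iff less_irrefl)
  have "(sqrt (of_int v))\<^sup>2 = real_of_int v" using \<open>v > 0\<close> by simp
  then have "real_of_int (a\<^sup>2) = real_of_int (v * b\<^sup>2)"
    unfolding eq using \<open>b \<noteq> 0\<close> by (simp add: field_simps)
  then have ab: "a\<^sup>2 = v * b\<^sup>2" by linarith
  then have "b\<^sup>2 dvd a\<^sup>2" by simp
  then obtain k where "a = b * k" by (auto simp: pow_divides_pow_iff)
  then have "v = k\<^sup>2" using ab \<open>b \<noteq> 0\<close> by (simp add: power_mult_distrib)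
  then show False using assms(2) by blast
qed

lemma int_plus_int_mult_irrational_eq_0:
  fixes a b :: int
  assumes "s \<notin> \<rat>" "of_int a + of_int b * s = (0 :: real)"
  shows "a = 0" "b = 0"
proof -
  show "b = 0"
  proof (rule ccontr)
    assume "b \<noteq> 0"
    then have "s = - of_int a / of_int b" using assms(2) by (simp add: field_simps)
    also have "\<dots> \<in> \<rat>" by simp
    finally show False using assms(1) by blast
  qed
  then show "a = 0" using assms(2) by simp
qed

text \<open>Comparing the coefficients of \<open>1\<close> and \<open>\<surd>v\<close> in \<open>y * (c x + d) = a x + b\<close> gives
\<open>a = n e + r\<close>, \<open>d = r - m e\<close> and \<open>q * (b - q e v) = (n - m) r - m n e\<close> with \<open>c = q e\<close>, and the determinant
becomes \<open>r\<^sup>2 - c\<^sup>2 v\<close>. That \<open>r = c m / q + d\<close> is an integer follows as its square is one;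
then \<open>q dvd c\<close> since \<open>m\<close> is prime to \<open>q\<close>.\<close>

lemma unimodular_related_iff_unit:
  fixes v q m n :: int
  assumes v: "v > 0" "\<not> (\<exists>k::int. v = k\<^sup>2)" and "q > 0" and "coprime m q"
  shows "unimodular_related (of_int m / of_int q + sqrt (of_int v)) (of_int n / of_int q + sqrt (of_int v))
    \<longleftrightarrow> (\<exists>r e :: int. \<bar>r\<^sup>2 - (q * e)\<^sup>2 * v\<bar> = 1 \<and> q dvd (n - m) * r - m * n * e)"
    (is "unimodular_related ?x ?y \<longleftrightarrow> ?R")
proof -
  define s where "s = sqrt (of_int v)"
  have s2: "s * s = of_int v" using v(1) by (simp add: s_def)
  have s: "s \<notin> \<rat>" unfolding s_def using v by (rule sqrt_irrational)
  have q: "real_of_int q \<noteq> 0" using \<open>q > 0\<close> by simp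
  define x y where "x = of_int m / of_int q + s" and "y = of_int n / of_int q + s"
  have qx: "of_int q * x = of_int m + of_int q * s" and qy: "of_int q * y = of_int n + of_int q * s"
    using q by (simp_all add: x_def y_def field_simps)
  have "unimodular_related x y \<longleftrightarrow> ?R"
  proof
    assume "unimodular_related x y"
    then obtain a b c d :: int where det: "\<bar>a * d - b * c\<bar> = 1"
      and xy: "y * (of_int c * x + of_int d) = of_int a * x + of_int b"
      unfolding unimodular_related_def by blast
    from xy have "of_int q * y * (of_int c * (of_int q * x) + of_int d * of_int q)
      = of_int q * of_int a * (of_int q * x) + of_int b * (of_int q * of_int q)"
      by algebra
    then have "of_int (n * (c * m + d * q) + q * q * c * v - q * a * m - b * (q * q))
      + of_int (q * (n * c + (c * m + d * q) - q * a)) * s = 0"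
      unfolding qx qy using s2 by (simp only: of_int_add of_int_mult of_int_diff) algebra
    note PQ = int_plus_int_mult_irrational_eq_0[OF s this]
    define R where "R = c * m + d * q"
    have qa: "q * a = n * c + R" using PQ(2) \<open>q > 0\<close> by (simp add: R_def)
    have qb: "n * R + q * q * c * v - q * a * m = b * (q * q)" using PQ(1) by (simp add: R_def)
    \<comment> \<open>The number \<open>R\<close> is \<open>q r\<close>; this identity is the norm equation for \<open>r\<close>, multiplied by \<open>q\<^sup>2\<close>.\<close>
    have "R\<^sup>2 - q\<^sup>2 * c\<^sup>2 * v = q\<^sup>2 * (a * d - b * c)"
      using qa qb R_def by algebra
    then have Rq: "R\<^sup>2 = q\<^sup>2 * (a * d - b * c + c\<^sup>2 * v)" by (simp add: algebra_simps)
    then have "q\<^sup>2 dvd R\<^sup>2" by simp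
    then obtain r where r: "R = q * r" by (auto simp: pow_divides_pow_iff)
    then have "c * m = q * (r - d)" by (simp add: R_def algebra_simps)
    then have "q dvd c * m" by simp
    then have "q dvd c" using \<open>coprime m q\<close> by (simp add: coprime_commute coprime_dvd_mult_left_iff)
    then obtain e where e: "c = q * e" by blast
    have "r\<^sup>2 = a * d - b * c + c\<^sup>2 * v"
      using Rq r \<open>q > 0\<close> by (simp add: power_mult_distrib)
    then have "\<bar>r\<^sup>2 - (q * e)\<^sup>2 * v\<bar> = 1" using det by (simp add: e)
    moreover have "(n - m) * r - m * n * e = q * (b - q * e * v)"
    proof -
      have "q * ((n - m) * r - m * n * e) = q * (q * (b - q * e * v))"
        using qa qb unfolding r e by algebra
      then show ?thesis using \<open>q > 0\<close> by simp
    qed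
    ultimately show ?R by (metis dvd_triv_left)
  next
    assume ?R
    then obtain r e f where re: "\<bar>r\<^sup>2 - (q * e)\<^sup>2 * v\<bar> = 1"
      and f: "(n - m) * r - m * n * e = q * f" by blast
    have "(n * e + r) * (r - m * e) - (v * q * e + f) * (q * e) = r\<^sup>2 - (q * e)\<^sup>2 * v"
      using f by algebra
    then have "\<bar>(n * e + r) * (r - m * e) - (v * q * e + f) * (q * e)\<bar> = 1" using re by simp
    moreover have "y * (of_int (q * e) * x + of_int (r - m * e))
      = of_int (n * e + r) * x + of_int (v * q * e + f)"
    proof -
      have f': "(of_int n - of_int m) * of_int r - of_int m * of_int n * of_int e
        = real_of_int q * of_int f"
        using f by (metis of_int_diff of_int_mult)
      have "of_int q * (y * (of_int (q * e) * x + of_int (r - m * e)))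
        = of_int q * (of_int (n * e + r) * x + of_int (v * q * e + f))"
        using qx qy s2 f' by (simp only: of_int_add of_int_mult of_int_diff) algebra
      then show ?thesis using q by simp
    qed
    ultimately show "unimodular_related x y" unfolding unimodular_related_def by blast
  qed
  then show ?thesis by (simp add: x_def y_def s_def)
qed

text \<open>The coefficients of \<open>(r + q e \<surd>v)^k = R + q E \<surd>v\<close> are congruent modulo \<open>q\<close> to the first terms of the
binomial expansion, \<open>R \<equiv> r^k\<close> and \<open>E \<equiv> k r^(k-1) e\<close>. The second is multiplied by \<open>r\<close> to avoid the
exponent \<open>k - 1\<close>.\<close>

lemma unit_power_cong:
  fixes r e q v :: int
  assumes "\<bar>r\<^sup>2 - (q * e)\<^sup>2 * v\<bar> = 1"
  shows "\<exists>R E :: int. \<bar>R\<^sup>2 - (q * E)\<^sup>2 * v\<bar> = 1 \<and> q dvd R - r ^ k \<and>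
    q dvd r * E - int k * r ^ k * e"
proof (induction k)
  case 0
  show ?case by (rule exI[of _ 1], rule exI[of _ 0]) simp
next
  case (Suc k)
  then obtain R E :: int where RE: "\<bar>R\<^sup>2 - (q * E)\<^sup>2 * v\<bar> = 1" "q dvd R - r ^ k"
    "q dvd r * E - int k * r ^ k * e" by blast
  define R' E' where "R' = r * R + v * q\<^sup>2 * e * E" and "E' = r * E + e * R"
  have "R'\<^sup>2 - (q * E')\<^sup>2 * v = (R\<^sup>2 - (q * E)\<^sup>2 * v) * (r\<^sup>2 - (q * e)\<^sup>2 * v)"
    unfolding R'_def E'_def by algebra
  then have "\<bar>R'\<^sup>2 - (q * E')\<^sup>2 * v\<bar> = 1" using RE(1) assms by (simp add: abs_mult)
  moreover have "R' - r ^ Suc k = r * (R - r ^ k) + q * (v * q * e * E)"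
    unfolding R'_def by (simp add: algebra_simps power2_eq_square)
  then have "q dvd R' - r ^ Suc k" using RE(2) by simp
  moreover have "r * E' - int (Suc k) * r ^ Suc k * e
      = r * (r * E - int k * r ^ k * e) + r * e * (R - r ^ k)"
    unfolding E'_def by (simp add: algebra_simps)
  then have "q dvd r * E' - int (Suc k) * r ^ Suc k * e" using RE(2,3) by simp
  ultimately show ?case by blast
qed

text \<open>From left to right the unit stays the same: congruent numbers have the same gcd with \<open>q\<close>, and the
factors \<open>r\<close>, \<open>m\<close>, \<open>n\<close> are prime to \<open>q\<close>. From right to left the unit is replaced by its \<open>k\<close>-th
power, with \<open>k\<close> a solution of \<open>m n e k \<equiv> (n - m) r\<close> modulo \<open>q\<close>.\<close>

lemma unit_congruence_iff_gcd:
  fixes v q m n :: int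
  assumes "q > 0" "coprime m q" "coprime n q"
  shows "(\<exists>r e :: int. \<bar>r\<^sup>2 - (q * e)\<^sup>2 * v\<bar> = 1 \<and> q dvd (n - m) * r - m * n * e)
    \<longleftrightarrow> (\<exists>r e :: int. \<bar>r\<^sup>2 - (q * e)\<^sup>2 * v\<bar> = 1 \<and> gcd e q = gcd (m - n) q)"
    (is "?L \<longleftrightarrow> ?R")
proof -
  have unit_coprime: "coprime r q" if "\<bar>r\<^sup>2 - (q * e)\<^sup>2 * v\<bar> = 1" for r e
  proof (rule coprimeI)
    fix c assume "c dvd r" "c dvd q"
    then have "c dvd r\<^sup>2 - (q * e)\<^sup>2 * v" by (simp add: power2_eq_square)
    then show "is_unit c" using that by (metis dvd_abs_iff)
  qed
  have gcd_n_m: "gcd ((n - m) * r) q = gcd (m - n) q" if "coprime r q" for r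
  proof -
    have "gcd ((n - m) * r) q = gcd (n - m) q"
      using that by (simp add: gcd_mult_left_right_cancel coprime_commute)
    also have "\<dots> = gcd (m - n) q" by (subst gcd_neg1_int[symmetric]) simp
    finally show ?thesis .
  qed
  have gcd_mne: "gcd (m * n * e) q = gcd e q" for e
    using assms(2,3) by (simp add: gcd_mult_left_left_cancel coprime_commute)
  show ?thesis
  proof
    assume ?L
    then obtain r e where re: "\<bar>r\<^sup>2 - (q * e)\<^sup>2 * v\<bar> = 1" "q dvd (n - m) * r - m * n * e" by blast
    then have "gcd ((n - m) * r) q = gcd (m * n * e) q"
      by (metis cong_gcd_eq cong_iff_dvd_diff)
    then show ?R using re(1) gcd_n_m[OF unit_coprime[OF re(1)]] gcd_mne by metis
  next
    assume ?R
    then obtain r e where re: "\<bar>r\<^sup>2 - (q * e)\<^sup>2 * v\<bar> = 1" "gcd e q = gcd (m - n) q" by blast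
    have r: "coprime r q" by (rule unit_coprime[OF re(1)])
    have "gcd (m * n * e) q dvd (n - m) * r"
      using gcd_mne re(2) gcd_n_m[OF r] by (metis gcd_dvd1)
    then obtain k0 where "[m * n * e * k0 = (n - m) * r] (mod q)"
      using cong_solve_dvd_int by blast
    \<comment> \<open>An exponent has to be nonnegative, so the least residue of the solution is taken.\<close>
    then have "[m * n * e * (k0 mod q) = (n - m) * r] (mod q)"
      by (metis cong_def mod_mult_right_eq)
    moreover define k where "k = nat (k0 mod q)"
    ultimately have k: "q dvd m * n * e * int k - (n - m) * r"
      using \<open>q > 0\<close> by (simp add: cong_iff_dvd_diff)
    obtain R E where RE: "\<bar>R\<^sup>2 - (q * E)\<^sup>2 * v\<bar> = 1" "q dvd R - r ^ k"
      "q dvd r * E - int k * r ^ k * e" using unit_power_cong[OF re(1), of k] by blast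
    have "r * ((n - m) * R - m * n * E) = (n - m) * r * (R - r ^ k)
        - m * n * (r * E - int k * r ^ k * e) - r ^ k * (m * n * e * int k - (n - m) * r)"
      by (simp add: algebra_simps)
    then have "q dvd r * ((n - m) * R - m * n * E)" using k RE(2,3) by simp
    then have "q dvd (n - m) * R - m * n * E"
      using r by (simp add: coprime_commute coprime_dvd_mult_right_iff)
    then show ?L using RE(1) by blast
  qed
qed

lemma conjugate_pair_sqrt:
  fixes v q m :: int
  assumes v: "v > 0" "\<not> (\<exists>k::int. v = k\<^sup>2)" and "q > 0"
  shows "conjugate_pair (4 * q ^ 4 * v) (of_int m / of_int q + sqrt (of_int v))
    (of_int m / of_int q - sqrt (of_int v))"
proof -
  define s where "s = sqrt (of_int v)"
  have s2: "s * s = of_int v" using v(1) by (simp add: s_def)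
  have s: "s \<notin> \<rat>" unfolding s_def using v by (rule sqrt_irrational)
  have q: "real_of_int q \<noteq> 0" using \<open>q > 0\<close> by simp
  define x x' where "x = of_int m / of_int q + s" and "x' = of_int m / of_int q - s"
  have "x \<notin> \<rat>" "x' \<notin> \<rat>" "x \<noteq> x'"
    using s by (auto simp: x_def x'_def Rats_add_iff Rats_diff_iff)
  moreover have "q\<^sup>2 \<noteq> 0" using \<open>q > 0\<close> by simp
  moreover have "of_int (- 2 * m * q) = - of_int (q\<^sup>2) * (x + x')"
    using q by (simp add: x_def x'_def power2_eq_square)
  moreover have "of_int (m\<^sup>2 - q\<^sup>2 * v) = of_int (q\<^sup>2) * (x * x')"
    using q by (simp add: x_def x'_def power2_eq_square field_simps flip: s2)
  moreover have "4 * q ^ 4 * v = (- 2 * m * q)\<^sup>2 - 4 * q\<^sup>2 * (m\<^sup>2 - q\<^sup>2 * v)"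
    by algebra
  ultimately show ?thesis
    unfolding conjugate_pair_def x_def[symmetric] x'_def[symmetric] s_def[symmetric] by blast
qed

theorem theorem1:
  fixes v q m n q1 :: int and x y :: real
  assumes "v > 0" and "q > 0"
    and "\<not> (\<exists>k::int. v = k\<^sup>2)"
    and "gcd m q = 1" and "gcd n q = 1"
    and "x = of_int m / of_int q + sqrt (of_int v)"
    and "y = of_int n / of_int q + sqrt (of_int v)"
    and "q1 = gcd (m - n) q"
  shows "x \<sim> y \<longleftrightarrow>
    (\<exists>r c :: int. r\<^sup>2 - c\<^sup>2 * v \<in> {1, -1} \<and> gcd c (q\<^sup>2) = q * q1)"
proof -
  have mn: "coprime m q" "coprime n q" using assms(4,5) by (simp_all add: coprime_iff_gcd_eq_1)
  have "y \<notin> \<rat>"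
    using conjugate_pair_sqrt[OF assms(1,3,2), of n] unfolding assms(7) conjugate_pair_def by blast
  have "x \<sim> y \<longleftrightarrow> unimodular_related x y"
    using conjugate_pair_sqrt[OF assms(1,3,2), of m] \<open>y \<notin> \<rat>\<close>
    unfolding assms(6) by (rule cfrac_equiv_iff_unimodular_related)
  also have "\<dots> \<longleftrightarrow>
      (\<exists>r e :: int. \<bar>r\<^sup>2 - (q * e)\<^sup>2 * v\<bar> = 1 \<and> gcd e q = q1)"
    unfolding assms(6,7,8) unimodular_related_iff_unit[OF assms(1,3,2) mn(1)]
    by (rule unit_congruence_iff_gcd[OF assms(2) mn])
  also have "\<dots> \<longleftrightarrow> (\<exists>r c :: int. r\<^sup>2 - c\<^sup>2 * v \<in> {1, -1} \<and> gcd c (q\<^sup>2) = q * q1)"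
  proof -
    \<comment> \<open>The substitution \<open>c = q e\<close> turns one gcd condition into the other.\<close>
    have *: "gcd (q * e) (q\<^sup>2) = q * gcd e q" for e
      using \<open>q > 0\<close> by (simp add: power2_eq_square gcd_mult_distrib_int[symmetric])
    have abs: "\<bar>z\<bar> = 1 \<longleftrightarrow> z \<in> {1, - 1}" for z :: int by auto
    have "q dvd c" if "gcd c (q\<^sup>2) = q * q1" for c
      using that by (metis dvd_triv_left gcd_dvd1 dvd_trans)
    then show ?thesis
      unfolding abs using \<open>q > 0\<close> * by (fastforce elim!: dvdE)
  qed
  finally show ?thesis .
qed

end
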